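(* Let $\Omega$ be a nonempty set, $Y$ a real Banach space, and $\mathcal X$ a Banach subspace of $\mathcal B(\Omega,Y)$. A subset $M$ of $\mathcal X$ is relatively compact in $\mathcal X$ if and only if it is bounded, extendedly equicontinuous and pointwise relatively compact.
   Context: $\mathcal B(\Omega,Y)$ is the Banach space of all bounded functions $f:\Omega\to Y$ with norm $\|f\|_\infty=\sup_{x\in\Omega}\|f(x)\|$. A Banach subspace of $\mathcal B(\Omega,Y)$ is a closed linear subspace equipped with $\|\cdot\|_\infty$ (possibly the whole space). A bounded set $M\subseteq\mathcal X$ is extendedly equicontinuous (with respect to $\mathcal X$) if for every $\varepsilon>0$ there are a finite partition $\{A_1,\dots,A_n\}$ of $\Omega$ and a finite set $\{\varphi_1,\dots,\varphi_m\}$ of functions in $\mathcal X$ such that for every $f\in M$ there is $j\in\{1,\dots,m\}$ with $\operatorname{diam}((f-\varphi_j)(A_i))\le\varepsilon$ for all $i=1,\dots,n$. A bounded set $M$ is pointwise relatively compact if $\mu_\alpha(M)=\sup_{x\in\Omega}\alpha(M(x))=0$, where $M(x)=\{f(x):f\in M\}$ and $\alpha$ is the Kuratowski measure of noncompactness in $Y$ (the infimum of all $\varepsilon>0$ such that the set can be covered by finitely many sets of diameter not greater than $\varepsilon$); equivalently, $M(x)$ is relatively compact in $Y$ for every $x\in\Omega$. *)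

theory Defs
  imports "HOL-Analysis.Analysis"
begin

section \<open>The Banach space of bounded functions\<close>

text \<open>The nonempty set \<open>\<Omega>\<close> is the type \<open>'a\<close>.\<close>

typedef (overloaded) ('a, 'b) bounded_fun =
  "{f :: 'a \<Rightarrow> 'b::real_normed_vector. bounded (range f)}"
  morphisms apply_bounded_fun Bounded_fun
  by (rule exI[of _ "\<lambda>_. 0"]) (auto simp: image_def)

declare [[coercion "apply_bounded_fun :: ('a, 'b::real_normed_vector) bounded_fun \<Rightarrow> 'a \<Rightarrow> 'b"]]

setup_lifting type_definition_bounded_fun

lemma bounded_apply_bounded_fun [intro, simp]: "bounded (range (apply_bounded_fun f))"
  using apply_bounded_fun[of f] by simp

lemma bounded_fun_eqI: "(\<And>x. apply_bounded_fun f x = apply_bounded_fun g x) \<Longrightarrow> f = g"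
  by (metis apply_bounded_fun_inject ext)

instantiation bounded_fun :: (type, real_normed_vector) real_vector
begin

lift_definition zero_bounded_fun :: "('a, 'b) bounded_fun" is "\<lambda>_. 0"
  by (auto simp: image_def)

lift_definition plus_bounded_fun ::
    "('a, 'b) bounded_fun \<Rightarrow> ('a, 'b) bounded_fun \<Rightarrow> ('a, 'b) bounded_fun"
  is "\<lambda>f g x. f x + g x"
  by (rule bounded_plus_comp)

lift_definition uminus_bounded_fun :: "('a, 'b) bounded_fun \<Rightarrow> ('a, 'b) bounded_fun"
  is "\<lambda>f x. - f x"
  by (simp add: bounded_uminus)

lift_definition minus_bounded_fun ::
    "('a, 'b) bounded_fun \<Rightarrow> ('a, 'b) bounded_fun \<Rightarrow> ('a, 'b) bounded_fun"
  is "\<lambda>f g x. f x - g x"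
  by (rule bounded_minus_comp)

lift_definition scaleR_bounded_fun :: "real \<Rightarrow> ('a, 'b) bounded_fun \<Rightarrow> ('a, 'b) bounded_fun"
  is "\<lambda>r f x. r *\<^sub>R f x"
  by (rule bounded_scaleR_comp)

instance
  by standard (transfer; simp add: algebra_simps fun_eq_iff)+

end

instantiation bounded_fun :: (type, real_normed_vector) real_normed_vector
begin

lift_definition norm_bounded_fun :: "('a, 'b) bounded_fun \<Rightarrow> real"
  is "\<lambda>f. SUP x. norm (f x)" .

definition dist_bounded_fun :: "('a, 'b) bounded_fun \<Rightarrow> ('a, 'b) bounded_fun \<Rightarrow> real"
  where "dist_bounded_fun f g = norm (f - g)"

definition sgn_bounded_fun :: "('a, 'b) bounded_fun \<Rightarrow> ('a, 'b) bounded_fun"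
  where "sgn_bounded_fun f = inverse (norm f) *\<^sub>R f"

definition uniformity_bounded_fun :: "(('a, 'b) bounded_fun \<times> ('a, 'b) bounded_fun) filter"
  where "uniformity_bounded_fun = (INF e\<in>{0<..}. principal {(f, g). dist f g < e})"

definition open_bounded_fun :: "('a, 'b) bounded_fun set \<Rightarrow> bool"
  where "open_bounded_fun S \<longleftrightarrow> (\<forall>f\<in>S. \<forall>\<^sub>F (f', g) in uniformity. f' = f \<longrightarrow> g \<in> S)"

lemma norm_apply_le_norm_bounded_fun:
  fixes f :: "('a, 'b) bounded_fun"
  shows "norm (f x) \<le> norm f"
  by transfer (auto intro!: cSUP_upper bounded_imp_bdd_above simp: bounded_norm_comp)

lemma norm_bounded_fun_le:
  fixes f :: "('a, 'b) bounded_fun"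
  assumes "\<And>x. norm (f x) \<le> c"
  shows "norm f \<le> c"
  using assms by transfer (auto intro!: cSUP_least)

instance
proof
  fix f g :: "('a, 'b) bounded_fun" and a :: real
  show "dist f g = norm (f - g)"
    by (rule dist_bounded_fun_def)
  show "sgn f = f /\<^sub>R norm f"
    by (rule sgn_bounded_fun_def)
  show "uniformity = (INF e\<in>{0<..}. principal {(f :: ('a, 'b) bounded_fun, g). dist f g < e})"
    by (rule uniformity_bounded_fun_def)
  show "open S \<longleftrightarrow> (\<forall>f\<in>S. \<forall>\<^sub>F (f', g) in uniformity. f' = f \<longrightarrow> g \<in> S)"
    for S :: "('a, 'b) bounded_fun set"
    by (rule open_bounded_fun_def)
  show "norm f = 0 \<longleftrightarrow> f = 0"
  proof
    assume "norm f = 0"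
    then have "f x = 0" for x
      using norm_apply_le_norm_bounded_fun[of f x] by simp
    then show "f = 0"
      by (intro bounded_fun_eqI) (simp add: zero_bounded_fun.rep_eq)
  next
    assume "f = 0"
    then show "norm f = 0"
      by (simp only: norm_bounded_fun.rep_eq zero_bounded_fun.rep_eq) simp
  qed
  show "norm (f + g) \<le> norm f + norm g"
  proof (rule norm_bounded_fun_le)
    fix x
    show "norm ((f + g) x) \<le> norm f + norm g"
      using norm_triangle_ineq[of "f x" "g x"] norm_apply_le_norm_bounded_fun[of f x]
        norm_apply_le_norm_bounded_fun[of g x]
      by (simp add: plus_bounded_fun.rep_eq)
  qed
  have le: "norm (c *\<^sub>R u) \<le> \<bar>c\<bar> * norm u" for c and u :: "('a, 'b) bounded_fun"
    by (rule norm_bounded_fun_le)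
      (simp add: scaleR_bounded_fun.rep_eq mult_left_mono norm_apply_le_norm_bounded_fun)
  show "norm (a *\<^sub>R f) = \<bar>a\<bar> * norm f"
  proof (cases "a = 0")
    case True
    have "norm (0 *\<^sub>R f) = 0"
      unfolding norm_bounded_fun.rep_eq scaleR_bounded_fun.rep_eq by simp
    with True show ?thesis by simp
  next
    case False
    have "inverse a *\<^sub>R a *\<^sub>R f = f"
      using False by (intro bounded_fun_eqI) (simp add: scaleR_bounded_fun.rep_eq)
    then have "\<bar>a\<bar> * norm f \<le> norm (a *\<^sub>R f)"
      using le[of "inverse a" "a *\<^sub>R f"] False by (simp add: field_simps)
    with le[of a f] show ?thesis by simp
  qed
qed

end

instance bounded_fun :: (type, banach) banach
proof
  fix X :: "nat \<Rightarrow> ('a, 'b) bounded_fun"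
  assume X: "Cauchy X"
  have le: "dist (X m x) (X n x) \<le> dist (X m) (X n)" for m n x
    using norm_apply_le_norm_bounded_fun[of "X m - X n" x]
    by (simp add: dist_norm minus_bounded_fun.rep_eq)
  have "uniformly_Cauchy_on UNIV (\<lambda>n. apply_bounded_fun (X n))"
    unfolding uniformly_Cauchy_on_def
    using X le unfolding Cauchy_def by (meson le_less_trans)
  then obtain l where l: "uniform_limit UNIV (\<lambda>n. apply_bounded_fun (X n)) l sequentially"
    using Cauchy_uniformly_convergent uniformly_convergent_on_def by blast
  have "bounded (range l)"
  proof -
    obtain N where N: "\<And>x. dist (X N x) (l x) < 1"
      using eventually_happens[OF uniform_limitD[OF l, of 1]] by auto
    have "norm (l x) \<le> norm (X N) + 1" for x
      using N[of x] norm_apply_le_norm_bounded_fun[of "X N" x] norm_triangle_sub[of "l x" "X N x"]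
      by (simp add: dist_norm norm_minus_commute)
    then show ?thesis
      by (auto simp: bounded_iff)
  qed
  then obtain L where L: "apply_bounded_fun L = l"
    by (metis Bounded_fun_inverse mem_Collect_eq)
  have "X \<longlonglongrightarrow> L"
  proof (rule tendstoI)
    fix e :: real assume "e > 0"
    then have "\<forall>\<^sub>F n in sequentially. \<forall>x. dist (X n x) (l x) < e / 2"
      using uniform_limitD[OF l, of "e / 2"] by simp
    then show "\<forall>\<^sub>F n in sequentially. dist (X n) L < e"
    proof eventually_elim
      case (elim n)
      have "norm (X n - L) \<le> e / 2"
        by (rule norm_bounded_fun_le)
          (use elim L in \<open>auto simp: minus_bounded_fun.rep_eq dist_norm intro: less_imp_le\<close>)
      with \<open>e > 0\<close> show ?case by (simp add: dist_norm)
    qed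
  qed
  then show "convergent X"
    by (rule convergentI)
qed

section \<open>Compactness notions\<close>

definition relatively_compact_in :: "'a::topological_space set \<Rightarrow> 'a set \<Rightarrow> bool"
  where "relatively_compact_in X M \<longleftrightarrow>
    M \<subseteq> X \<and> compactin (top_of_set X) (top_of_set X closure_of M)"

text \<open>The conjunct \<open>bounded (D)\<close> is needed because \<^const>\<open>diameter\<close> has no meaningful value on
  unbounded sets. The measure is \<open>\<infinity>\<close> on sets that have no finite cover by bounded sets.\<close>

definition kuratowski_measure :: "'a::metric_space set \<Rightarrow> ereal"
  where "kuratowski_measure A =
    (INF \<epsilon>\<in>{\<epsilon>::real. \<epsilon> > 0 \<and>
        (\<exists>\<D>. finite \<D> \<and> A \<subseteq> \<Union>\<D> \<and> (\<forall>D\<in>\<D>. bounded D \<and> diameter D \<le> \<epsilon>))}. ereal \<epsilon>)"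

definition pointwise_kuratowski_measure ::
    "('a, 'b::real_normed_vector) bounded_fun set \<Rightarrow> ereal"
  where "pointwise_kuratowski_measure M =
    (SUP x. kuratowski_measure ((\<lambda>f. apply_bounded_fun f x) ` M))"

definition pointwise_relatively_compact ::
    "('a, 'b::real_normed_vector) bounded_fun set \<Rightarrow> bool"
  where "pointwise_relatively_compact M \<longleftrightarrow>
    bounded M \<and> pointwise_kuratowski_measure M = 0"

text \<open>Since \<open>f - \<phi>\<close> is a bounded function, \<^const>\<open>diameter\<close> is applied to bounded sets only.\<close>

definition extendedly_equicontinuous ::
    "('a, 'b::real_normed_vector) bounded_fun set \<Rightarrow> ('a, 'b) bounded_fun set \<Rightarrow> bool"
  where "extendedly_equicontinuous X M \<longleftrightarrow>
    M \<subseteq> X \<and> bounded M \<and>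
    (\<forall>\<epsilon>>0. \<exists>\<A> \<Phi>. finite \<A> \<and> partition_on UNIV \<A> \<and> finite \<Phi> \<and> \<Phi> \<subseteq> X \<and>
      (\<forall>f\<in>M. \<exists>\<phi>\<in>\<Phi>. \<forall>A\<in>\<A>. diameter (apply_bounded_fun (f - \<phi>) ` A) \<le> \<epsilon>))"

end

theory Submission
  imports Defs
begin

text \<open>Since \<open>X\<close> is closed in a complete space, relative compactness in \<open>X\<close> means total boundedness.
  A finite \<open>\<epsilon>\<close>-net of \<open>M\<close>, together with the trivial partition, witnesses extended equicontinuity,
  and evaluating it at \<open>x\<close> gives a net of \<open>M(x)\<close>. Conversely, choose a point \<open>p A\<close> in each
  partition cell \<open>A\<close> and cover each \<open>M(p A)\<close> by finitely many sets of diameter at most \<open>\<epsilon>\<close>. Two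
  functions that share the same approximating \<open>\<phi>\<close> and take values in the same covering set at every
  \<open>p A\<close> are at distance at most \<open>3\<epsilon>\<close>, and there are only finitely many such combinations.\<close>

section \<open>Relative compactness and finite nets\<close>

text \<open>In a complete space the closed set \<open>closure S\<close> is complete, so its
  compactness is total boundedness. Keeping the centres in \<open>closure S\<close> later places the
  approximating functions in the closed set \<open>X\<close>.\<close>

lemma compact_closure_iff_finite_nets:
  fixes S :: "'a::complete_space set"
  shows "compact (closure S) \<longleftrightarrow>
    (\<forall>e>0. \<exists>k. finite k \<and> k \<subseteq> closure S \<and> S \<subseteq> (\<Union>x\<in>k. cball x e))" (is "_ \<longleftrightarrow> ?nets")
proof
  assume "compact (closure S)"
  then have "\<exists>k. finite k \<and> k \<subseteq> closure S \<and> closure S \<subseteq> (\<Union>x\<in>k. ball x e)" if "e > 0" for e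
    using that seq_compact_imp_totally_bounded compact_imp_seq_compact by blast
  moreover have "S \<subseteq> (\<Union>x\<in>k. cball x e)" if "closure S \<subseteq> (\<Union>x\<in>k. ball x e)" for k e
  proof -
    have "S \<subseteq> (\<Union>x\<in>k. ball x e)"
      using closure_subset that by (rule subset_trans)
    also have "\<dots> \<subseteq> (\<Union>x\<in>k. cball x e)"
      by (intro UN_mono ball_subset_cball order_refl)
    finally show ?thesis .
  qed
  ultimately show ?nets
    by meson
next
  assume nets: ?nets
  have "\<exists>k. finite k \<and> closure S \<subseteq> (\<Union>x\<in>k. ball x e)" if "e > 0" for e :: real
  proof -
    \<comment> \<open>A finite union of closed balls is closed, so it contains
      \<open>closure S\<close> as well; half the radius leaves room to return to open balls.\<close>
    obtain k where k: "finite k" "S \<subseteq> (\<Union>x\<in>k. cball x (e / 2))"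
      using nets \<open>e > 0\<close> by (meson half_gt_zero)
    have "closure S \<subseteq> (\<Union>x\<in>k. cball x (e / 2))"
      using k by (intro closure_minimal closed_UN) auto
    also have "\<dots> \<subseteq> (\<Union>x\<in>k. ball x e)"
      using \<open>e > 0\<close> by fastforce
    finally show ?thesis
      using k(1) by blast
  qed
  then show "compact (closure S)"
    by (simp add: compact_eq_totally_bounded complete_eq_closed)
qed

lemma compact_closure_obtain_finite_net:
  fixes S :: "'a::complete_space set"
  assumes "compact (closure S)" "e > 0"
  obtains k where "finite k" "k \<subseteq> closure S" "S \<subseteq> (\<Union>x\<in>k. cball x e)"
  using assms unfolding compact_closure_iff_finite_nets by metis

text \<open>One representative per value of \<open>F\<close>, picked by \<open>inv_into M F\<close>,
  forms the net: every element is within \<open>e\<close> of the representative of its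
  fibre.\<close>

lemma finite_net_of_finite_invariant:
  fixes M :: "'a::metric_space set"
  assumes "finite (F ` M)"
    and "\<And>f g. f \<in> M \<Longrightarrow> g \<in> M \<Longrightarrow> F f = F g \<Longrightarrow> dist f g \<le> e"
  shows "\<exists>k. finite k \<and> k \<subseteq> M \<and> M \<subseteq> (\<Union>x\<in>k. cball x e)"
proof (intro exI conjI)
  let ?k = "inv_into M F ` F ` M"
  show "finite ?k"
    using assms(1) by blast
  show "?k \<subseteq> M"
    by (auto intro: inv_into_into)
  show "M \<subseteq> (\<Union>x\<in>?k. cball x e)"
  proof
    fix f assume "f \<in> M"
    then have "dist (inv_into M F (F f)) f \<le> e"
      by (intro assms(2)) (auto intro: inv_into_into f_inv_into_f)
    with \<open>f \<in> M\<close> show "f \<in> (\<Union>x\<in>?k. cball x e)"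
      by auto
  qed
qed

text \<open>A closed \<open>X\<close> contains \<open>closure M\<close>, so the closure of
  \<open>M\<close> in the subspace topology is the ambient one.\<close>

lemma relatively_compact_in_closed_iff:
  assumes "closed X" "M \<subseteq> X"
  shows "relatively_compact_in X M \<longleftrightarrow> compact (closure M)"
proof -
  have "closure M \<subseteq> X"
    using assms by (simp add: closure_minimal)
  moreover have "X \<inter> M = M"
    using assms(2) by blast
  ultimately have "top_of_set X closure_of M = closure M"
    by (simp add: closure_of_subtopology Int_absorb1)
  with \<open>closure M \<subseteq> X\<close> assms(2) show ?thesis
    by (simp add: relatively_compact_in_def compactin_subtopology)
qed

section \<open>Vanishing of the Kuratowski measure\<close>

lemma kuratowski_measure_nonneg: "0 \<le> kuratowski_measure A"
  unfolding kuratowski_measure_def by (rule INF_greatest) auto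

text \<open>The admissible bounds form an upward closed set of positive reals, so their infimum is 0
  exactly when every positive real is admissible.\<close>

lemma kuratowski_measure_eq_0_iff:
  "kuratowski_measure A = 0 \<longleftrightarrow>
    (\<forall>e>0. \<exists>\<D>. finite \<D> \<and> A \<subseteq> \<Union>\<D> \<and> (\<forall>D\<in>\<D>. bounded D \<and> diameter D \<le> e))"
  (is "_ \<longleftrightarrow> (\<forall>e>0. ?cov e)")
proof
  assume 0: "kuratowski_measure A = 0"
  show "\<forall>e>0. ?cov e"
  proof (intro allI impI)
    fix e :: real assume "e > 0"
    then have "kuratowski_measure A < ereal e"
      using 0 by simp
    then obtain d where "d < e" "?cov d"
      unfolding kuratowski_measure_def by (auto simp: INF_less_iff)
    then show "?cov e"
      by (meson less_imp_le order_trans)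
  qed
next
  assume cov: "\<forall>e>0. ?cov e"
  have "kuratowski_measure A \<le> 0"
  proof (rule ereal_le_epsilon2)
    fix e :: real assume "e > 0"
    then show "kuratowski_measure A \<le> 0 + ereal e"
      using cov unfolding kuratowski_measure_def by (auto intro!: INF_lower)
  qed
  then show "kuratowski_measure A = 0"
    using kuratowski_measure_nonneg by (rule antisym)
qed

lemma pointwise_kuratowski_measure_eq_0_iff:
  "pointwise_kuratowski_measure M = 0 \<longleftrightarrow>
    (\<forall>x. kuratowski_measure ((\<lambda>f. apply_bounded_fun f x) ` M) = 0)"
proof
  assume 0: "pointwise_kuratowski_measure M = 0"
  have "kuratowski_measure ((\<lambda>f. apply_bounded_fun f x) ` M) \<le> pointwise_kuratowski_measure M" for x
    unfolding pointwise_kuratowski_measure_def by (rule SUP_upper) simp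
  with 0 show "\<forall>x. kuratowski_measure ((\<lambda>f. apply_bounded_fun f x) ` M) = 0"
    by (simp add: antisym kuratowski_measure_nonneg)
qed (simp add: pointwise_kuratowski_measure_def)

section \<open>Pointwise estimates in the supremum norm\<close>

lemma dist_apply_le_dist_bounded_fun:
  fixes f g :: "('a, 'b::real_normed_vector) bounded_fun"
  shows "dist (f x) (g x) \<le> dist f g"
  using norm_apply_le_norm_bounded_fun[of "f - g" x]
  by (simp add: dist_norm minus_bounded_fun.rep_eq)

lemma dist_bounded_fun_le:
  fixes f g :: "('a, 'b::real_normed_vector) bounded_fun"
  assumes "\<And>x. dist (f x) (g x) \<le> c"
  shows "dist f g \<le> c"
  unfolding dist_norm
  using assms by (intro norm_bounded_fun_le) (simp add: dist_norm minus_bounded_fun.rep_eq)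

lemma dist_apply_le_diameter:
  fixes h :: "('a, 'b::real_normed_vector) bounded_fun"
  assumes "x \<in> A" "y \<in> A"
  shows "dist (h x) (h y) \<le> diameter (h ` A)"
  using assms by (intro diameter_bounded_bound bounded_subset[OF bounded_apply_bounded_fun]) auto

lemma diameter_image_bounded_fun_le:
  fixes h :: "('a, 'b::real_normed_vector) bounded_fun"
  shows "diameter (h ` A) \<le> 2 * norm h"
proof (rule diameter_le)
  \<comment> \<open>This covers empty \<open>A\<close>, where the diameter is 0 by
    convention.\<close>
  show "h ` A \<noteq> {} \<or> 0 \<le> 2 * norm h"
    by simp
  show "norm (u - v) \<le> 2 * norm h" if "u \<in> h ` A" "v \<in> h ` A" for u v
    using that norm_apply_le_norm_bounded_fun[of h] norm_triangle_ineq4[of u v]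
    by (smt (verit) imageE)
qed

section \<open>The two implications\<close>

lemma extendedly_equicontinuous_if_compact_closure:
  fixes M :: "('a, 'b::banach) bounded_fun set"
  assumes "compact (closure M)" "closure M \<subseteq> X"
  shows "extendedly_equicontinuous X M"
  unfolding extendedly_equicontinuous_def
proof (intro conjI allI impI)
  show "M \<subseteq> X"
    using closure_subset assms(2) by (rule subset_trans)
  show "bounded M"
    using compact_imp_bounded[OF assms(1)] closure_subset by (rule bounded_subset)
  fix \<epsilon> :: real assume "\<epsilon> > 0"
  \<comment> \<open>Radius \<epsilon>/2 suffices because the diameter of an image is at most twice
    the norm.\<close>
  then obtain \<Phi> where \<Phi>: "finite \<Phi>" "\<Phi> \<subseteq> closure M" "M \<subseteq> (\<Union>\<phi>\<in>\<Phi>. cball \<phi> (\<epsilon> / 2))"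
    using compact_closure_obtain_finite_net[OF assms(1) half_gt_zero] by metis
  have "\<Phi> \<subseteq> X"
    using \<Phi>(2) assms(2) by (rule subset_trans)
  have "\<exists>\<phi>\<in>\<Phi>. \<forall>A\<in>{UNIV}. diameter (apply_bounded_fun (f - \<phi>) ` A) \<le> \<epsilon>" if "f \<in> M" for f
  proof -
    obtain \<phi> where "\<phi> \<in> \<Phi>" "norm (f - \<phi>) \<le> \<epsilon> / 2"
      using subsetD[OF \<Phi>(3) \<open>f \<in> M\<close>] by (auto simp: dist_norm norm_minus_commute)
    then show ?thesis
      using diameter_image_bounded_fun_le[of "f - \<phi>" UNIV] by (intro bexI[of _ \<phi>]) auto
  qed
  moreover have "partition_on UNIV {UNIV}"
    by (rule partition_on_space) simp
  ultimately show "\<exists>\<A> \<Phi>. finite \<A> \<and> partition_on UNIV \<A> \<and> finite \<Phi> \<and> \<Phi> \<subseteq> X \<and>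
      (\<forall>f\<in>M. \<exists>\<phi>\<in>\<Phi>. \<forall>A\<in>\<A>. diameter (apply_bounded_fun (f - \<phi>) ` A) \<le> \<epsilon>)"
    using \<Phi>(1) \<open>\<Phi> \<subseteq> X\<close>
    by (intro exI[of _ "{UNIV}"] exI[of _ \<Phi>]) simp
qed

text \<open>Evaluation at \<open>x\<close> does not increase distances, so a net of \<open>M\<close>
  of radius \<open>e / 2\<close> becomes a finite cover of the values by balls of diameter at most
  \<open>e\<close>.\<close>

lemma kuratowski_measure_evaluation_eq_0:
  fixes M :: "('a, 'b::banach) bounded_fun set"
  assumes "compact (closure M)"
  shows "kuratowski_measure ((\<lambda>f. apply_bounded_fun f x) ` M) = 0"
  unfolding kuratowski_measure_eq_0_iff
proof (intro allI impI)
  fix e :: real assume "e > 0"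
  then obtain k where k: "finite k" "M \<subseteq> (\<Union>\<phi>\<in>k. cball \<phi> (e / 2))"
    using compact_closure_obtain_finite_net[OF assms half_gt_zero] by metis
  let ?\<D> = "(\<lambda>\<phi>. cball (apply_bounded_fun \<phi> x) (e / 2)) ` k"
  have "f x \<in> \<Union>?\<D>" if "f \<in> M" for f
  proof -
    obtain \<phi> where "\<phi> \<in> k" "dist \<phi> f \<le> e / 2"
      using subsetD[OF k(2) \<open>f \<in> M\<close>] by auto
    then have "f x \<in> cball (\<phi> x) (e / 2)"
      using dist_apply_le_dist_bounded_fun[of \<phi> x f] by simp
    with \<open>\<phi> \<in> k\<close> show ?thesis
      by blast
  qed
  moreover have "bounded D \<and> diameter D \<le> e" if "D \<in> ?\<D>" for D
  proof -
    obtain c where "D = cball c (e / 2)"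
      using \<open>D \<in> ?\<D>\<close> by blast
    moreover have "diameter (cball c (e / 2)) \<le> e"
    proof (rule diameter_le)
      fix u v assume "u \<in> cball c (e / 2)" "v \<in> cball c (e / 2)"
      then show "norm (u - v) \<le> e"
        using dist_triangle3[of u v c] by (simp add: dist_norm)
    qed (use \<open>e > 0\<close> in simp)
    ultimately show ?thesis
      by simp
  qed
  ultimately show "\<exists>\<D>. finite \<D> \<and> (\<lambda>f. apply_bounded_fun f x) ` M \<subseteq> \<Union>\<D> \<and>
      (\<forall>D\<in>\<D>. bounded D \<and> diameter D \<le> e)"
    using k(1) by (intro exI[of _ ?\<D>] conjI finite_imageI image_subsetI ballI) blast+
qed

lemma compact_closure_if_extendedly_equicontinuous:
  fixes M :: "('a, 'b::banach) bounded_fun set"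
  assumes "extendedly_equicontinuous X M"
    and "\<And>x. kuratowski_measure ((\<lambda>f. apply_bounded_fun f x) ` M) = 0"
  shows "compact (closure M)"
  unfolding compact_closure_iff_finite_nets
proof (intro allI impI)
  fix e :: real assume "e > 0"
  \<comment> \<open>Three errors add up: the oscillations of \<open>f - \<phi> f\<close> and
    \<open>g - \<phi> g\<close> on a cell, and the distance of \<open>f\<close> and \<open>g\<close>
    at its chosen point.\<close>
  define \<epsilon> where "\<epsilon> = e / 3"
  with \<open>e > 0\<close> have "\<epsilon> > 0"
    by simp
  with assms(1) obtain \<A> \<Phi> where "finite \<A>" and \<A>: "partition_on UNIV \<A>" and "finite \<Phi>"
    and "\<forall>f\<in>M. \<exists>\<phi>\<in>\<Phi>. \<forall>A\<in>\<A>. diameter (apply_bounded_fun (f - \<phi>) ` A) \<le> \<epsilon>"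
    unfolding extendedly_equicontinuous_def by meson
  then obtain \<phi> where \<phi>: "\<And>f. f \<in> M \<Longrightarrow> \<phi> f \<in> \<Phi>"
    "\<And>f A. f \<in> M \<Longrightarrow> A \<in> \<A> \<Longrightarrow> diameter (apply_bounded_fun (f - \<phi> f) ` A) \<le> \<epsilon>"
    by metis
  \<comment> \<open>The choice is meaningful on the cells, since a partition has no empty
    member.\<close>
  define p where "p = (\<lambda>A::'a set. SOME x. x \<in> A)"
  have p: "p A \<in> A" if "A \<in> \<A>" for A
    using that partition_onD3[OF \<A>] unfolding p_def by (metis some_in_eq)
  have "\<forall>x. \<exists>\<D>. finite \<D> \<and> (\<lambda>f. apply_bounded_fun f x) ` M \<subseteq> \<Union>\<D> \<and>
      (\<forall>D\<in>\<D>. bounded D \<and> diameter D \<le> \<epsilon>)"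
    using assms(2) \<open>\<epsilon> > 0\<close> unfolding kuratowski_measure_eq_0_iff by blast
  then obtain \<D> where \<D>: "\<And>x. finite (\<D> x)"
    "\<And>x. (\<lambda>f. apply_bounded_fun f x) ` M \<subseteq> \<Union>(\<D> x)"
    "\<And>x D. D \<in> \<D> x \<Longrightarrow> bounded D \<and> diameter D \<le> \<epsilon>"
    by metis
  have "\<exists>D\<in>\<D> x. f x \<in> D" if "f \<in> M" for f x
    using subsetD[OF \<D>(2) imageI[OF that]] by (rule UnionE) (rule bexI)
  then obtain c where c: "\<And>f x. f \<in> M \<Longrightarrow> c f x \<in> \<D> x \<and> apply_bounded_fun f x \<in> c f x"
    by metis
  \<comment> \<open>\<open>F\<close> records the approximating function and the covering sets hit at
    the chosen points. Restricting to \<open>\<A>\<close> puts the second component into a finite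
    product of finite sets.\<close>
  define F where "F = (\<lambda>f. (\<phi> f, restrict (\<lambda>A. c f (p A)) \<A>))"
  have "F ` M \<subseteq> \<Phi> \<times> (\<Pi>\<^sub>E A\<in>\<A>. \<D> (p A))"
    using \<phi>(1) c by (auto simp: F_def)
  then have "finite (F ` M)"
    by (rule finite_subset) (intro finite_cartesian_product finite_PiE \<open>finite \<A>\<close> \<open>finite \<Phi>\<close> \<D>(1))
  moreover have "dist f g \<le> e" if "f \<in> M" "g \<in> M" "F f = F g" for f g
  proof (rule dist_bounded_fun_le)
    fix x
    obtain A where A: "A \<in> \<A>" "x \<in> A"
      using partition_onD1[OF \<A>] by blast
    define y where "y = p A"
    have "y \<in> A"
      using p A(1) by (simp add: y_def)
    have "\<phi> f = \<phi> g"
      using that(3) by (simp add: F_def)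
    have "c f y = c g y"
      using that(3) A(1) unfolding F_def y_def by (metis prod.inject restrict_apply')
    then have "dist (f y) (g y) \<le> \<epsilon>"
      using c[of f y] c[of g y] that \<D>(3) diameter_bounded_bound order_trans by metis
    \<comment> \<open>Stated for a general \<open>h\<close> so that it applies to both
      \<open>f\<close> and \<open>g\<close>, with the same subtracted function.\<close>
    moreover have "dist ((h - \<phi> f) x) ((h - \<phi> f) y) \<le> \<epsilon>" if "h \<in> M" "\<phi> h = \<phi> f" for h
      using that dist_apply_le_diameter[OF A(2) \<open>y \<in> A\<close>, of "h - \<phi> f"] \<phi>(2)[OF that(1) A(1)]
      by simp
    then have "dist ((f - \<phi> f) x) ((f - \<phi> f) y) \<le> \<epsilon>" "dist ((g - \<phi> f) x) ((g - \<phi> f) y) \<le> \<epsilon>"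
      using that \<open>\<phi> f = \<phi> g\<close> by auto
    \<comment> \<open>Because the same \<open>\<phi> f\<close> is subtracted from \<open>f\<close>
      and \<open>g\<close>, its values at \<open>x\<close> and \<open>y\<close> cancel.\<close>
    moreover have "f x - g x =
        ((f - \<phi> f) x - (f - \<phi> f) y) - ((g - \<phi> f) x - (g - \<phi> f) y) + (f y - g y)"
      by (simp add: minus_bounded_fun.rep_eq)
    ultimately have "norm (f x - g x) \<le> \<epsilon> + \<epsilon> + \<epsilon>"
      unfolding dist_norm
      by (metis add_mono norm_triangle_le norm_triangle_le_diff)
    then show "dist (f x) (g x) \<le> e"
      by (simp add: \<epsilon>_def dist_norm)
  qed
  ultimately have "\<exists>k. finite k \<and> k \<subseteq> M \<and> M \<subseteq> (\<Union>x\<in>k. cball x e)"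
    by (rule finite_net_of_finite_invariant)
  then show "\<exists>k. finite k \<and> k \<subseteq> closure M \<and> M \<subseteq> (\<Union>x\<in>k. cball x e)"
    using closure_subset[of M] by (meson subset_trans)
qed

theorem corollary3p1:
  fixes X M :: "('a, 'b::banach) bounded_fun set"
  assumes "subspace X" and "closed X" and "M \<subseteq> X"
  shows "relatively_compact_in X M \<longleftrightarrow>
    bounded M \<and> extendedly_equicontinuous X M \<and> pointwise_relatively_compact M"
proof -
  have pointwise: "pointwise_relatively_compact M \<longleftrightarrow>
      bounded M \<and> (\<forall>x. kuratowski_measure ((\<lambda>f. apply_bounded_fun f x) ` M) = 0)"
    by (simp only: pointwise_relatively_compact_def pointwise_kuratowski_measure_eq_0_iff)
  have "extendedly_equicontinuous X M" if "compact (closure M)"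
    using that closure_minimal[OF assms(3,2)] by (rule extendedly_equicontinuous_if_compact_closure)
  \<comment> \<open>In the forward direction, boundedness is read off from extended equicontinuity,
    which contains it.\<close>
  moreover have "bounded M" if "extendedly_equicontinuous X M"
    using that by (simp only: extendedly_equicontinuous_def)
  ultimately show ?thesis
    unfolding relatively_compact_in_closed_iff[OF assms(2,3)] pointwise
    using kuratowski_measure_evaluation_eq_0[of M] compact_closure_if_extendedly_equicontinuous[of X M]
    by metis
qed

end
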